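(* Let $k$ be a positive integer, $m=4k+1$, and let $M$ be a maximum induced matching of the grid $G_{3,m}$. Then at least $2k$ vertices of the row $U_1=\{u_1v_1,u_1v_2,\dots,u_1v_m\}$ are saturated by $M$.
   Context: For integers $n,m\geq 2$, the grid $G_{n,m}$ is the Cartesian product of the path $P_n=u_1u_2\cdots u_n$ and the path $P_m=v_1v_2\cdots v_m$; its vertices are written $u_iv_j$ ($1\le i\le n$, $1\le j\le m$), and $u_iv_j$, $u_kv_l$ are adjacent iff either $i=k$ and $|j-l|=1$, or $j=l$ and $|i-k|=1$. An induced matching of a graph $G$ is a set $M$ of pairwise vertex-disjoint edges such that no edge of $G$ joins endpoints of two distinct edges of $M$; a maximum induced matching is one of largest possible size. A vertex is saturated by $M$ if it is an endpoint of an edge of $M$. *)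

theory Defs
  imports Main
begin

text \<open>
  A finite simple graph is a pair of a vertex set and a set of edges, each edge being the
  two-element set of its endpoints.
\<close>

type_synonym 'a graph = "'a set \<times> 'a set set"

abbreviation verts :: "'a graph \<Rightarrow> 'a set" where
  "verts G \<equiv> fst G"

abbreviation edges :: "'a graph \<Rightarrow> 'a set set" where
  "edges G \<equiv> snd G"

definition path_graph :: "nat \<Rightarrow> nat graph" where
  "path_graph n = ({1..n}, {{i, i + 1} | i. 1 \<le> i \<and> i < n})"

definition cartesian_product :: "'a graph \<Rightarrow> 'b graph \<Rightarrow> ('a \<times> 'b) graph" where
  "cartesian_product G H =
     (verts G \<times> verts H,
      {{(a, b), (c, d)} | a b c d.
         (a = c \<and> a \<in> verts G \<and> {b, d} \<in> edges H) \<or>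
         (b = d \<and> b \<in> verts H \<and> {a, c} \<in> edges G)})"

text \<open>The vertex \<open>u\<^sub>i v\<^sub>j\<close> of the grid is the pair \<open>(i, j)\<close>.\<close>

definition grid :: "nat \<Rightarrow> nat \<Rightarrow> (nat \<times> nat) graph" where
  "grid n m = cartesian_product (path_graph n) (path_graph m)"

definition induced_matching :: "'a graph \<Rightarrow> 'a set set \<Rightarrow> bool" where
  "induced_matching G M \<longleftrightarrow>
     M \<subseteq> edges G \<and>
     (\<forall>e\<in>M. \<forall>f\<in>M. e \<noteq> f \<longrightarrow>
        e \<inter> f = {} \<and> (\<forall>x\<in>e. \<forall>y\<in>f. {x, y} \<notin> edges G))"

text \<open>
  Meaningful for graphs with finitely many edges only, since infinite sets have cardinality 0;
  \<open>finite_edges_grid\<close> below shows that grids are such graphs.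
\<close>

definition maximum_induced_matching :: "'a graph \<Rightarrow> 'a set set \<Rightarrow> bool" where
  "maximum_induced_matching G M \<longleftrightarrow>
     induced_matching G M \<and> (\<forall>N. induced_matching G N \<longrightarrow> card N \<le> card M)"

definition saturated :: "'a set set \<Rightarrow> 'a \<Rightarrow> bool" where
  "saturated M v \<longleftrightarrow> (\<exists>e\<in>M. v \<in> e)"

definition row :: "nat \<Rightarrow> nat \<Rightarrow> (nat \<times> nat) set" where
  "row m i = {(i, j) | j. 1 \<le> j \<and> j \<le> m}"

lemma verts_grid: "verts (grid n m) = {1..n} \<times> {1..m}"
  by (simp add: grid_def cartesian_product_def path_graph_def)

lemma edge_path_graph_iff:
  "{i, j} \<in> edges (path_graph n) \<longleftrightarrow>
     i \<in> {1..n} \<and> j \<in> {1..n} \<and> \<bar>int i - int j\<bar> = 1"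
proof
  assume "{i, j} \<in> edges (path_graph n)"
  then show "i \<in> {1..n} \<and> j \<in> {1..n} \<and> \<bar>int i - int j\<bar> = 1"
    by (auto simp: path_graph_def doubleton_eq_iff)
next
  assume A: "i \<in> {1..n} \<and> j \<in> {1..n} \<and> \<bar>int i - int j\<bar> = 1"
  then have "j = i + 1 \<or> i = j + 1" by linarith
  then show "{i, j} \<in> edges (path_graph n)"
    using A by (auto simp: path_graph_def doubleton_eq_iff)
qed

lemma edge_grid_iff:
  "{(i, j), (k, l)} \<in> edges (grid n m) \<longleftrightarrow>
     (i, j) \<in> verts (grid n m) \<and> (k, l) \<in> verts (grid n m) \<and>
     ((i = k \<and> \<bar>int j - int l\<bar> = 1) \<or> (j = l \<and> \<bar>int i - int k\<bar> = 1))"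
proof -
  let ?P = "\<lambda>a b c d. (a = c \<and> a \<in> verts (path_graph n) \<and> {b, d} \<in> edges (path_graph m)) \<or>
                      (b = d \<and> b \<in> verts (path_graph m) \<and> {a, c} \<in> edges (path_graph n))"
  have sym: "?P a b c d \<longleftrightarrow> ?P c d a b" for a b c d
    by (metis insert_commute)
  have "{(i, j), (k, l)} \<in> edges (grid n m) \<longleftrightarrow>
        (\<exists>a b c d. {(i, j), (k, l)} = {(a, b), (c, d)} \<and> ?P a b c d)"
    by (simp add: grid_def cartesian_product_def)
  also have "\<dots> \<longleftrightarrow> ?P i j k l"
    using sym by (auto simp only: doubleton_eq_iff prod.inject)
  also have "\<dots> \<longleftrightarrow> (i, j) \<in> verts (grid n m) \<and> (k, l) \<in> verts (grid n m) \<and>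
     ((i = k \<and> \<bar>int j - int l\<bar> = 1) \<or> (j = l \<and> \<bar>int i - int k\<bar> = 1))"
    unfolding edge_path_graph_iff verts_grid by (auto simp: path_graph_def)
  finally show ?thesis .
qed

lemma finite_edges_grid: "finite (edges (grid n m))"
proof (rule finite_subset)
  show "edges (grid n m) \<subseteq> Pow (verts (grid n m))"
  proof
    fix e assume e: "e \<in> edges (grid n m)"
    then obtain i j k l where "e = {(i, j), (k, l)}"
      by (auto simp: grid_def cartesian_product_def)
    with e edge_grid_iff show "e \<in> Pow (verts (grid n m))" by blast
  qed
  show "finite (Pow (verts (grid n m)))" by (simp add: verts_grid)
qed

end

theory Submission
  imports Defs
begin

text \<open>
  A saturated vertex has exactly one saturated neighbour, so a 4-cycle of \<open>G\<close> contains at most two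
  saturated vertices. Cutting the rows 2 and 3 into \<open>2 k\<close> such 4-cycles and one remaining column
  shows that they contain at most \<open>4 k + 2\<close> saturated vertices. As an explicit induced
  matching has \<open>3 k + 1\<close> edges, at least \<open>6 k + 2\<close> vertices are saturated by \<open>M\<close>, which
  leaves at least \<open>2 k\<close> of them for row 1.
\<close>

lemma card_edge_grid:
  assumes "e \<in> edges (grid n m)"
  shows "card e = 2"
proof -
  obtain i j k l where e: "e = {(i, j), (k, l)}"
    using assms by (auto simp: grid_def cartesian_product_def)
  with assms have "(i, j) \<noteq> (k, l)"
    by (auto simp: edge_grid_iff)
  with e show ?thesis by simp
qed

lemma edge_grid_subset:
  assumes "e \<in> edges (grid n m)"
  shows "e \<subseteq> {1..n} \<times> {1..m}"
proof -
  obtain i j k l where "e = {(i, j), (k, l)}"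
    using assms by (auto simp: grid_def cartesian_product_def)
  with assms show ?thesis
    by (auto simp: edge_grid_iff verts_grid)
qed

lemma card_Union_induced_matching_grid:
  assumes "induced_matching (grid n m) M"
  shows "card (\<Union>M) = 2 * card M"
proof -
  have M: "M \<subseteq> edges (grid n m)"
    using assms by (simp add: induced_matching_def)
  have "card (\<Union>M) = (\<Sum>e\<in>M. card e)"
  proof (rule card_Union_disjoint)
    show "pairwise disjnt M"
      using assms by (auto simp: induced_matching_def pairwise_def disjnt_def)
    show "finite e" if "e \<in> M" for e
      using that M card_edge_grid by (metis card.infinite subsetD zero_neq_numeral)
  qed
  also have "\<dots> = (\<Sum>e\<in>M. 2)"
    using M card_edge_grid by (intro sum.cong) auto
  finally show ?thesis by simp
qed

text \<open>Distinct edges of \<open>M\<close> are joined by no edge of the grid, so adjacent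
  saturated vertices lie in the same edge of \<open>M\<close>. Otherwise one two-element edge would
  contain three distinct vertices.\<close>

lemma induced_matching_no_saturated_path:
  assumes "induced_matching (grid n m) M"
    and "{x, y} \<in> edges (grid n m)" "{y, z} \<in> edges (grid n m)"
    and "x \<in> \<Union>M" "y \<in> \<Union>M" "z \<in> \<Union>M"
  shows "x = z"
proof (rule ccontr)
  assume "x \<noteq> z"
  obtain e f g where efg: "e \<in> M" "f \<in> M" "g \<in> M" "x \<in> e" "y \<in> f" "z \<in> g"
    using assms by blast
  have "e = f" "f = g"
    using assms(1-3) efg unfolding induced_matching_def by blast+
  then have sub: "{x, y, z} \<subseteq> f"
    using efg by auto
  have "card f = 2"
    using assms(1) efg card_edge_grid by (auto simp: induced_matching_def)
  \<comment> \<open>As cardinalities of edges, these say that \<open>x \<noteq> y\<close> and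
    \<open>y \<noteq> z\<close>.\<close>
  moreover have "card {x, y} = 2" "card {y, z} = 2"
    using assms(2,3) card_edge_grid by blast+
  with \<open>x \<noteq> z\<close> have "card {x, y, z} = 3"
    by (auto simp: card_insert_if split: if_splits)
  ultimately show False
    using sub by (metis card.infinite card_mono numeral_le_iff semiring_norm(72) zero_neq_numeral
        not_less_eq_eq numeral_2_eq_2 numeral_3_eq_3 order_refl)
qed

text \<open>Any three of four cyclically arranged elements are consecutive, so the hypotheses
  exclude every triple and \<open>T\<close> lies in a pair.\<close>

lemma card_le_2_if_no_triple:
  assumes "T \<subseteq> {a, b, c, d}"
    and "\<not> {a, b, c} \<subseteq> T" "\<not> {b, c, d} \<subseteq> T" "\<not> {c, d, a} \<subseteq> T" "\<not> {d, a, b} \<subseteq> T"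
  shows "card T \<le> 2"
proof -
  have "T \<subseteq> {a, b} \<or> T \<subseteq> {a, c} \<or> T \<subseteq> {a, d} \<or> T \<subseteq> {b, c} \<or> T \<subseteq> {b, d} \<or> T \<subseteq> {c, d}"
    using assms by blast
  moreover have "card T \<le> 2" if "T \<subseteq> {x, y}" for x y
  proof -
    have "card T \<le> card {x, y}"
      using that by (intro card_mono) auto
    also have "\<dots> \<le> 2"
      by (simp add: card_insert_if)
    finally show ?thesis .
  qed
  ultimately show ?thesis by blast
qed

text \<open>Three consecutive corners of the square form a path with distinct ends, so they are not
  all saturated.\<close>

lemma card_saturated_square:
  assumes M: "induced_matching (grid n m) M"
    and "1 \<le> i" "i < n" "1 \<le> j" "j < m"
  shows "card (\<Union>M \<inter> {i, Suc i} \<times> {j, Suc j}) \<le> 2"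
proof (rule card_le_2_if_no_triple)
  let ?a = "(i, j)" and ?b = "(Suc i, j)" and ?c = "(Suc i, Suc j)" and ?d = "(i, Suc j)"
  have E: "{?a, ?b} \<in> edges (grid n m)" "{?b, ?c} \<in> edges (grid n m)"
    "{?c, ?d} \<in> edges (grid n m)" "{?d, ?a} \<in> edges (grid n m)"
    using assms by (simp_all add: edge_grid_iff verts_grid)
  note path = induced_matching_no_saturated_path[OF M]
  show "\<Union>M \<inter> {i, Suc i} \<times> {j, Suc j} \<subseteq> {?a, ?b, ?c, ?d}" by auto
  show "\<not> {?a, ?b, ?c} \<subseteq> \<Union>M \<inter> {i, Suc i} \<times> {j, Suc j}" using path[OF E(1,2)] by auto
  show "\<not> {?b, ?c, ?d} \<subseteq> \<Union>M \<inter> {i, Suc i} \<times> {j, Suc j}" using path[OF E(2,3)] by auto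
  show "\<not> {?c, ?d, ?a} \<subseteq> \<Union>M \<inter> {i, Suc i} \<times> {j, Suc j}" using path[OF E(3,4)] by auto
  show "\<not> {?d, ?a, ?b} \<subseteq> \<Union>M \<inter> {i, Suc i} \<times> {j, Suc j}" using path[OF E(4,1)] by auto
qed

lemma card_saturated_two_rows:
  assumes "induced_matching (grid n m) M" "1 \<le> i" "i < n" "2 * q \<le> m"
  shows "card (\<Union>M \<inter> {i, Suc i} \<times> {1..2 * q}) \<le> 2 * q"
  using assms(4)
proof (induction q)
  case 0
  then show ?case by simp
next
  case (Suc q)
  \<comment> \<open>The two new columns form one more square, \<open>?B\<close>.\<close>
  let ?A = "\<Union>M \<inter> {i, Suc i} \<times> {1..2 * q}"
  let ?B = "\<Union>M \<inter> {i, Suc i} \<times> {Suc (2 * q), Suc (Suc (2 * q))}"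
  have "{1..2 * Suc q} = {1..2 * q} \<union> {Suc (2 * q), Suc (Suc (2 * q))}"
    by auto
  then have "\<Union>M \<inter> {i, Suc i} \<times> {1..2 * Suc q} = ?A \<union> ?B"
    by blast
  then have "card (\<Union>M \<inter> {i, Suc i} \<times> {1..2 * Suc q}) \<le> card ?A + card ?B"
    by (metis card_Un_le)
  also have "\<dots> \<le> 2 * q + 2"
    using Suc assms by (intro add_mono card_saturated_square) auto
  finally show ?case by simp
qed

text \<open>
  The edges of the pattern in columns \<open>4 t + 1, \<dots>, 4 t + 4\<close>; rows 1 and 3 are
  swapped when \<open>t\<close> is odd.
\<close>

fun pattern_edge :: "nat \<times> nat \<Rightarrow> (nat \<times> nat) set" where
  "pattern_edge (t, c) = (let p = t mod 2 in
     if c = 0 then {(1 + p, 4 * t + 1), (2 + p, 4 * t + 1)}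
     else if c = 1 then {(3 - 2 * p, 4 * t + 2), (3 - 2 * p, 4 * t + 3)}
     else {(1 + 2 * p, 4 * t + 3), (1 + 2 * p, 4 * t + 4)})"

text \<open>The last block is cut off after column \<open>4 * k + 1\<close>, so \<open>t = k\<close>
  contributes only its vertical edge.\<close>

definition pattern_index :: "nat \<Rightarrow> (nat \<times> nat) set" where
  "pattern_index k = {0..k} \<times> {0} \<union> {0..<k} \<times> {1, 2}"

lemma card_pattern_index: "card (pattern_index k) = 3 * k + 1"
  unfolding pattern_index_def by (subst card_Un_disjoint) (auto simp: card_cartesian_product)

lemma pattern_edge_in_edges:
  assumes "i \<in> pattern_index k"
  shows "pattern_edge i \<in> edges (grid 3 (4 * k + 1))"
proof -
  obtain t c where i: "i = (t, c)" by (cases i)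
  have "t mod 2 = 0 \<or> t mod 2 = 1" by auto
  then show ?thesis
    using assms by (auto simp: i pattern_index_def edge_grid_iff verts_grid)
qed

text \<open>Only coordinates matter here, so the grid is arbitrary. The claim that the vertices
  differ also yields the injectivity of \<open>pattern_edge\<close> later.\<close>

lemma pattern_edge_separated:
  assumes "i \<in> pattern_index k" "j \<in> pattern_index k" "i \<noteq> j"
    and "(a, b) \<in> pattern_edge i" "(c, d) \<in> pattern_edge j"
  shows "(a, b) \<noteq> (c, d) \<and> {(a, b), (c, d)} \<notin> edges (grid n m)"
proof -
  obtain t x where i: "i = (t, x)" by (cases i)
  obtain s y where j: "j = (s, y)" by (cases j)
  have xy: "x \<in> {0, 1, 2}" "y \<in> {0, 1, 2}"
    using assms by (auto simp: i j pattern_index_def)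
  have p: "t mod 2 = 0 \<or> t mod 2 = 1" "s mod 2 = 0 \<or> s mod 2 = 1" by auto
  have "s = t \<or> s = Suc t \<or> t = Suc s \<or> s \<ge> t + 2 \<or> t \<ge> s + 2" by arith
  then show ?thesis
  proof (elim disjE)
    assume "s = t"
    then show ?thesis
      using p(1) xy assms(3-5) by (auto simp: i j edge_grid_iff)
  next
    \<comment> \<open>Consecutive blocks have opposite parity. The swap of rows 1 and 3 puts the
      vertical edge of the next block into the two rows that avoid the horizontal edge ending in
      column \<open>4 * t + 4\<close>.\<close>
    assume "s = Suc t"
    then show ?thesis
      using p(1) xy assms(4,5) by (auto simp: i j edge_grid_iff mod_Suc)
  next
    assume "t = Suc s"
    then show ?thesis
      using p(2) xy assms(4,5) by (auto simp: i j edge_grid_iff mod_Suc)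
  next
    \<comment> \<open>A whole block lies in between, so the columns \<open>b\<close> and
      \<open>d\<close> are too far apart for adjacency, whatever the rows.\<close>
    assume "s \<ge> t + 2"
    moreover have "b \<le> 4 * t + 4" "4 * s + 1 \<le> d"
      using xy assms(4,5) by (auto simp: i j Let_def)
    ultimately show ?thesis by (auto simp: edge_grid_iff)
  next
    assume "t \<ge> s + 2"
    moreover have "d \<le> 4 * s + 4" "4 * t + 1 \<le> b"
      using xy assms(4,5) by (auto simp: i j Let_def)
    ultimately show ?thesis by (auto simp: edge_grid_iff)
  qed
qed

lemma induced_matching_pattern:
  "induced_matching (grid 3 (4 * k + 1)) (pattern_edge ` pattern_index k)"
  unfolding induced_matching_def
proof (intro conjI ballI impI)
  show "pattern_edge ` pattern_index k \<subseteq> edges (grid 3 (4 * k + 1))"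
    using pattern_edge_in_edges by blast
next
  fix e f
  assume ef: "e \<in> pattern_edge ` pattern_index k" "f \<in> pattern_edge ` pattern_index k" "e \<noteq> f"
  then obtain i j where ij: "i \<in> pattern_index k" "j \<in> pattern_index k" "i \<noteq> j"
      "e = pattern_edge i" "f = pattern_edge j"
    by auto
  note sep = pattern_edge_separated[OF ij(1-3), folded ij(4,5)]
  show "e \<inter> f = {}"
    using sep by fast
  show "{x, y} \<notin> edges (grid 3 (4 * k + 1))" if "x \<in> e" "y \<in> f" for x y
    using sep that by (cases x; cases y) blast
qed

text \<open>Distinct indices give disjoint nonempty edges, hence distinct ones.\<close>

lemma card_pattern: "card (pattern_edge ` pattern_index k) = 3 * k + 1"
proof -
  have "inj_on pattern_edge (pattern_index k)"
  proof (rule inj_onI, rule ccontr)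
    fix i j
    assume ij: "i \<in> pattern_index k" "j \<in> pattern_index k" "i \<noteq> j"
      and eq: "pattern_edge i = pattern_edge j"
    have "pattern_edge i \<noteq> {}"
      using card_edge_grid[OF pattern_edge_in_edges[OF ij(1)]] by auto
    then obtain a b where "(a, b) \<in> pattern_edge i" by auto
    with pattern_edge_separated[OF ij] eq show False by blast
  qed
  then show ?thesis
    by (simp add: card_image card_pattern_index)
qed

theorem theorem3p7:
  fixes k m :: nat and M :: "(nat \<times> nat) set set"
  assumes "k > 0"
    and "m = 4 * k + 1"
    and "maximum_induced_matching (grid 3 m) M"
  shows "2 * k \<le> card {v \<in> row m 1. saturated M v}"
proof -
  have M: "induced_matching (grid 3 m) M"
    using assms(3) by (simp add: maximum_induced_matching_def)
  have "3 * k + 1 \<le> card M"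
    using assms(2,3) induced_matching_pattern[of k] card_pattern[of k]
    by (metis maximum_induced_matching_def)
  then have lower: "6 * k + 2 \<le> card (\<Union>M)"
    by (simp add: card_Union_induced_matching_grid[OF M])
  have "\<Union>M \<subseteq> {1..3} \<times> {1..m}"
    using M edge_grid_subset by (fastforce simp: induced_matching_def)
  \<comment> \<open>Since \<open>m - 1 = 2 * (2 * k)\<close>, only column \<open>m\<close> stays
    unpaired. Its vertices in rows 2 and 3 are counted whether saturated or not, which costs
    2.\<close>
  then have "\<Union>M \<subseteq> {v \<in> row m 1. saturated M v} \<union>
      (\<Union>M \<inter> {2, Suc 2} \<times> {1..2 * (2 * k)} \<union> {2, 3} \<times> {m})"
    using assms(2) by (fastforce simp: row_def saturated_def)
  then have "card (\<Union>M) \<le> card ({v \<in> row m 1. saturated M v} \<union>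
      (\<Union>M \<inter> {2, Suc 2} \<times> {1..2 * (2 * k)} \<union> {2, 3} \<times> {m}))"
    by (rule card_mono[rotated]) (simp add: row_def)
  also have "\<dots> \<le> card {v \<in> row m 1. saturated M v} +
      (card (\<Union>M \<inter> {2, Suc 2} \<times> {1..2 * (2 * k)}) + card ({2, 3::nat} \<times> {m}))"
    by (intro order_trans[OF card_Un_le] add_left_mono card_Un_le)
  also have "\<dots> \<le> card {v \<in> row m 1. saturated M v} + (2 * (2 * k) + 2)"
    using card_saturated_two_rows[OF M, of 2 "2 * k"] assms(2)
    by (simp add: card_cartesian_product)
  finally show ?thesis using lower by simp
qed

end
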